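(* Let $\mathcal T$ be a triangulation of a connected manifold. The assignment $$d_{ij}=\frac{\ell_{ij}^2+w_i-w_j}{2\ell_{ij}}$$ defines an injective map from the set of weighted triangulations $(\mathcal T,\ell,w)$ modulo weight scalings into the set of duality triangulations $(\mathcal T,d)$. It is a bijection onto the set of those duality triangulations $(\mathcal T,d)$ which satisfy $$\sum_{k=1}^{r}\left(d_{i_k i_{k-1}}^2-d_{i_{k-1}i_k}^2\right)=0$$ for all loops $j=i_0,i_1,\dots,i_r=j$ of vertices with $\{i_{k-1},i_k\}\in\mathcal T_1$ for $k=1,\dots,r$.
   Context: $\mathcal T$ is a topological triangulation of an $n$-dimensional manifold; $\mathcal T_k$ denotes its set of $k$-simplices and $\mathcal T_1^+$ its set of directed edges (so $(i,j)\neq(j,i)$). A Euclidean triangulation $(\mathcal T,\ell)$ is an assignment $\ell:\mathcal T_1\to(0,\infty)$ such that each simplex of $\mathcal T$ is realized by a nondegenerate Euclidean simplex with the assigned edge lengths. A weighted triangulation $(\mathcal T,\ell,w)$ is a Euclidean triangulation with a function $w:\mathcal T_0\to\mathbb R$. A weight scaling replaces $w_i$ by $w_i+t$ for all vertices $i$ simultaneously, with one $t\in\mathbb R$, leaving $\ell$ unchanged. A duality triangulation $(\mathcal T,d)$ is a function $d:\mathcal T_1^+\to\mathbb R$ such that $d_{ij}^2+d_{jk}^2+d_{ki}^2=d_{ji}^2+d_{ik}^2+d_{kj}^2$ for each $\{i,j,k\}\in\mathcal T_2$ and such that the induced lengths $\ell_{ij}=d_{ij}+d_{ji}$ make $(\mathcal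 T,\ell)$ a Euclidean triangulation. *)

theory Defs
  imports "HOL-Analysis.Analysis"
begin

section \<open>Triangulated manifolds\<close>

definition simplicial_complex_on :: "'v set set \<Rightarrow> bool" where
  "simplicial_complex_on T \<longleftrightarrow>
     (\<forall>s\<in>T. finite s \<and> s \<noteq> {}) \<and>
     (\<forall>s\<in>T. \<forall>s'. s' \<subseteq> s \<and> s' \<noteq> {} \<longrightarrow> s' \<in> T)"

definition simplices :: "'v set set \<Rightarrow> nat \<Rightarrow> 'v set set" where
  "simplices T k = {s \<in> T. card s = k + 1}"

text \<open>The vertices themselves, rather than the singletons in \<^term>\<open>simplices T 0\<close>.\<close>

definition vertices :: "'v set set \<Rightarrow> 'v set" where
  "vertices T = {v. {v} \<in> simplices T 0}"

text \<open>\<^term>\<open>i \<noteq> j\<close> is implied, as an edge has exactly two elements.\<close>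

definition directed_edges :: "'v set set \<Rightarrow> ('v \<times> 'v) set" where
  "directed_edges T = {(i, j). {i, j} \<in> simplices T 1}"

text \<open>Points of the closed cell of a simplex are given by barycentric coordinates.\<close>

definition closed_cell :: "'v set \<Rightarrow> ('v \<Rightarrow> real) set" where
  "closed_cell s = {x. (\<forall>v. 0 \<le> x v) \<and> (\<forall>v. v \<notin> s \<longrightarrow> x v = 0) \<and> (\<Sum>v\<in>s. x v) = 1}"

text \<open>The weak topology, coherent with the Euclidean topologies of the closed cells; \<open>T\<close> may be
  infinite.\<close>

definition geometric_realization :: "'v set set \<Rightarrow> ('v \<Rightarrow> real) topology" where
  "geometric_realization T = topology (\<lambda>U. U \<subseteq> (\<Union>s\<in>T. closed_cell s) \<and>
     (\<forall>s\<in>T. openin (subtopology (powertop_real UNIV) (closed_cell s)) (U \<inter> closed_cell s)))"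

lemma openin_geometric_realization:
  "openin (geometric_realization T) U \<longleftrightarrow> U \<subseteq> (\<Union>s\<in>T. closed_cell s) \<and>
     (\<forall>s\<in>T. openin (subtopology (powertop_real UNIV) (closed_cell s)) (U \<inter> closed_cell s))"
proof -
  have "istopology (\<lambda>U. U \<subseteq> (\<Union>s\<in>T. closed_cell s) \<and>
     (\<forall>s\<in>T. openin (subtopology (powertop_real UNIV) (closed_cell s)) (U \<inter> closed_cell s)))"
    (is "istopology ?P")
    unfolding istopology_def
  proof (intro conjI allI impI)
    fix U V assume "?P U" "?P V"
    moreover have "U \<inter> V \<inter> closed_cell s = (U \<inter> closed_cell s) \<inter> (V \<inter> closed_cell s)" for s
      by blast
    ultimately show "U \<inter> V \<subseteq> (\<Union>s\<in>T. closed_cell s)"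
      "\<forall>s\<in>T. openin (subtopology (powertop_real UNIV) (closed_cell s)) (U \<inter> V \<inter> closed_cell s)"
      by (auto intro: openin_Int)
  next
    fix \<K> assume "\<forall>K\<in>\<K>. ?P K"
    then have K: "K \<subseteq> (\<Union>s\<in>T. closed_cell s)"
      "s \<in> T \<Longrightarrow> openin (subtopology (powertop_real UNIV) (closed_cell s)) (K \<inter> closed_cell s)"
      if "K \<in> \<K>" for K s
      using that by auto
    show "\<Union>\<K> \<subseteq> (\<Union>s\<in>T. closed_cell s)"
      using K(1) by blast
    show "\<forall>s\<in>T. openin (subtopology (powertop_real UNIV) (closed_cell s)) (\<Union>\<K> \<inter> closed_cell s)"
    proof
      fix s assume "s \<in> T"
      then have "openin (subtopology (powertop_real UNIV) (closed_cell s))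
          (\<Union>K\<in>\<K>. K \<inter> closed_cell s)"
        using K(2) by blast
      then show "openin (subtopology (powertop_real UNIV) (closed_cell s)) (\<Union>\<K> \<inter> closed_cell s)"
        by (simp only: Int_Union2)
    qed
  qed
  then show ?thesis
    by (simp add: geometric_realization_def topology_inverse')
qed

definition topological_manifold :: "nat \<Rightarrow> 'm topology \<Rightarrow> bool" where
  "topological_manifold n M \<longleftrightarrow>
     Hausdorff_space M \<and> second_countable M \<and>
     (\<forall>x\<in>topspace M. \<exists>U V. openin M U \<and> x \<in> U \<and> openin (Euclidean_space n) V \<and>
        subtopology M U homeomorphic_space subtopology (Euclidean_space n) V)"

definition triangulates :: "'v set set \<Rightarrow> 'm topology \<Rightarrow> bool" where
  "triangulates T M \<longleftrightarrow>
     simplicial_complex_on T \<and> geometric_realization T homeomorphic_space M"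


section \<open>Euclidean, weighted and duality triangulations\<close>

text \<open>A \<open>k\<close>-simplex is realized in \<^term>\<open>topspace (Euclidean_space k)\<close>, i.e. by points of
  type \<^typ>\<open>nat \<Rightarrow> real\<close> whose coordinates from \<open>k\<close> on vanish. Nondegeneracy is affine
  independence; it is spelled out because \<^const>\<open>affine_dependent\<close> needs a
  \<^class>\<open>real_vector\<close> type, whereas \<open>k\<close> varies over the faces of one triangulation.\<close>

definition euclidean_realization ::
    "'v set \<Rightarrow> ('v set \<Rightarrow> real) \<Rightarrow> ('v \<Rightarrow> nat \<Rightarrow> real) \<Rightarrow> bool" where
  "euclidean_realization s len p \<longleftrightarrow>
     (\<forall>u\<in>s. p u \<in> topspace (Euclidean_space (card s - 1))) \<and>
     (\<forall>u\<in>s. \<forall>v\<in>s. u \<noteq> v \<longrightarrow> L2_set (\<lambda>m. p u m - p v m) {..<card s - 1} = len {u, v}) \<and>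
     (\<forall>c. (\<Sum>v\<in>s. c v) = 0 \<and> (\<forall>m. (\<Sum>v\<in>s. c v * p v m) = 0) \<longrightarrow> (\<forall>v\<in>s. c v = (0::real)))"

text \<open>Functions on simplices, vertices and directed edges are extensional, so that equality of
  functions is equality on these domains.\<close>

definition euclidean_triangulations :: "'v set set \<Rightarrow> ('v set \<Rightarrow> real) set" where
  "euclidean_triangulations T =
     {len \<in> simplices T 1 \<rightarrow>\<^sub>E {0<..}. \<forall>s\<in>T. \<exists>p. euclidean_realization s len p}"

definition weighted_triangulations ::
    "'v set set \<Rightarrow> (('v set \<Rightarrow> real) \<times> ('v \<Rightarrow> real)) set" where
  "weighted_triangulations T = euclidean_triangulations T \<times> (vertices T \<rightarrow>\<^sub>E UNIV)"

definition weight_scaling ::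
    "'v set set \<Rightarrow> ((('v set \<Rightarrow> real) \<times> ('v \<Rightarrow> real)) \<times> (('v set \<Rightarrow> real) \<times> ('v \<Rightarrow> real))) set" where
  "weight_scaling T = {((len, w), (len', w')).
     (len, w) \<in> weighted_triangulations T \<and> (len', w') \<in> weighted_triangulations T \<and>
     len' = len \<and> (\<exists>t. \<forall>i\<in>vertices T. w' i = w i + t)}"

lemma equiv_weight_scaling: "equiv (weighted_triangulations T) (weight_scaling T)"
proof (rule equivI)
  show "weight_scaling T \<subseteq> weighted_triangulations T \<times> weighted_triangulations T"
    by (auto simp: weight_scaling_def)
  show "refl_on (weighted_triangulations T) (weight_scaling T)"
    by (auto simp: refl_on_def weight_scaling_def intro: exI[of _ 0])
  show "sym (weight_scaling T)"
  proof (rule symI)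
    fix a b assume "(a, b) \<in> weight_scaling T"
    then obtain len w w' t where "a = (len, w)" "b = (len, w')"
      "a \<in> weighted_triangulations T" "b \<in> weighted_triangulations T"
      "\<forall>i\<in>vertices T. w' i = w i + t"
      by (auto simp: weight_scaling_def)
    then show "(b, a) \<in> weight_scaling T"
      by (auto simp: weight_scaling_def intro!: exI[of _ "- t"])
  qed
  show "trans (weight_scaling T)"
  proof (rule transI)
    fix a b c assume "(a, b) \<in> weight_scaling T" "(b, c) \<in> weight_scaling T"
    then obtain len w w' w'' t t' where "a = (len, w)" "c = (len, w'')"
      "a \<in> weighted_triangulations T" "c \<in> weighted_triangulations T"
      "\<forall>i\<in>vertices T. w' i = w i + t" "\<forall>i\<in>vertices T. w'' i = w' i + t'"
      unfolding weight_scaling_def by blast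
    then show "(a, c) \<in> weight_scaling T"
      by (auto simp: weight_scaling_def intro!: exI[of _ "t + t'"])
  qed
qed

text \<open>The values of \<open>len\<close> are determined by \<open>d\<close>, so the existential only names the induced
  lengths.\<close>

definition duality_triangulations :: "'v set set \<Rightarrow> ('v \<times> 'v \<Rightarrow> real) set" where
  "duality_triangulations T = {d \<in> directed_edges T \<rightarrow>\<^sub>E UNIV.
     (\<forall>i j k. {i, j, k} \<in> simplices T 2 \<longrightarrow>
        (d (i, j))\<^sup>2 + (d (j, k))\<^sup>2 + (d (k, i))\<^sup>2 = (d (j, i))\<^sup>2 + (d (i, k))\<^sup>2 + (d (k, j))\<^sup>2) \<and>
     (\<exists>len\<in>euclidean_triangulations T. \<forall>(i, j)\<in>directed_edges T. len {i, j} = d (i, j) + d (j, i))}"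

definition loop_condition :: "'v set set \<Rightarrow> ('v \<times> 'v \<Rightarrow> real) \<Rightarrow> bool" where
  "loop_condition T d \<longleftrightarrow>
     (\<forall>(r::nat) (i::nat \<Rightarrow> 'v). i 0 = i r \<and> (\<forall>k\<le>r. i k \<in> vertices T) \<and>
        (\<forall>k\<in>{1..r}. {i (k - 1), i k} \<in> simplices T 1) \<longrightarrow>
        (\<Sum>k=1..r. (d (i k, i (k - 1)))\<^sup>2 - (d (i (k - 1), i k))\<^sup>2) = 0)"

definition weighted_to_duality ::
    "'v set set \<Rightarrow> ('v set \<Rightarrow> real) \<times> ('v \<Rightarrow> real) \<Rightarrow> 'v \<times> 'v \<Rightarrow> real" where
  "weighted_to_duality T = (\<lambda>(len, w). \<lambda>(i, j)\<in>directed_edges T.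
     ((len {i, j})\<^sup>2 + w i - w j) / (2 * len {i, j}))"

text \<open>The map on equivalence classes induced by \<open>f\<close>; meaningful when \<open>f\<close> is constant on each
  class.\<close>

definition induced_map :: "('a \<Rightarrow> 'b) \<Rightarrow> 'a set \<Rightarrow> 'b" where
  "induced_map f C = the_elem (f ` C)"

end

theory Submission
  imports Defs
begin

text \<open>Write \<open>\<ell>\<close> for the length of the edge \<open>ij\<close>. The defining formula for \<open>d\<close> is equivalent to
  \<open>d\<^sub>i\<^sub>j + d\<^sub>j\<^sub>i = \<ell>\<close> together with \<open>d\<^sub>j\<^sub>i\<^sup>2 - d\<^sub>i\<^sub>j\<^sup>2 = w\<^sub>j - w\<^sub>i\<close>.
  Hence \<open>d\<close> determines the lengths, and the 1-cochain \<open>d\<^sub>j\<^sub>i\<^sup>2 - d\<^sub>i\<^sub>j\<^sup>2\<close> is the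
  coboundary of \<open>w\<close>. Connectedness of the manifold makes the edge graph connected, so \<open>w\<close> is unique
  up to a constant, and it exists, by summation along walks, iff the cochain vanishes on all loops.\<close>

section \<open>Faces, edges and vertices of a simplicial complex\<close>

lemma face_in_complex:
  assumes "simplicial_complex_on T" "s \<in> T" "s' \<subseteq> s" "s' \<noteq> {}"
  shows "s' \<in> T"
  using assms(1)[unfolded simplicial_complex_on_def, THEN conjunct2, rule_format, OF assms(2)] assms(3,4)
  by simp

lemma edge_in_simplices:
  assumes "simplicial_complex_on T" "s \<in> T" "i \<in> s" "j \<in> s" "i \<noteq> j"
  shows "{i, j} \<in> simplices T 1"
proof -
  have "{i, j} \<in> T" using face_in_complex[OF assms(1,2)] assms(3,4) by simp
  with assms(5) show ?thesis by (simp add: simplices_def)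
qed

lemma edge_vertices:
  assumes "simplicial_complex_on T" "{i, j} \<in> simplices T 1"
  shows "i \<in> vertices T" "j \<in> vertices T"
proof -
  have "{i, j} \<in> T" using assms(2) by (simp add: simplices_def)
  then have "{i} \<in> T" "{j} \<in> T" using face_in_complex[OF assms(1)] by simp_all
  then show "i \<in> vertices T" "j \<in> vertices T" by (simp_all add: simplices_def vertices_def)
qed

section \<open>Connectedness of the realization and of the edge graph\<close>

lemma topspace_geometric_realization:
  "topspace (geometric_realization T) = (\<Union>s\<in>T. closed_cell s)"
proof
  show "topspace (geometric_realization T) \<subseteq> (\<Union>s\<in>T. closed_cell s)"
    using openin_geometric_realization[of T] openin_topspace by blast
  have "openin (subtopology (powertop_real UNIV) (closed_cell s))
      ((\<Union>s\<in>T. closed_cell s) \<inter> closed_cell s)" if "s \<in> T" for s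
  proof -
    have "(\<Union>s\<in>T. closed_cell s) \<inter> closed_cell s
        = topspace (subtopology (powertop_real UNIV) (closed_cell s))"
      using that by auto
    then show ?thesis by (metis openin_topspace)
  qed
  then have "openin (geometric_realization T) (\<Union>s\<in>T. closed_cell s)"
    by (simp add: openin_geometric_realization)
  then show "(\<Union>s\<in>T. closed_cell s) \<subseteq> topspace (geometric_realization T)"
    by (rule openin_subset)
qed

text \<open>As \<open>P\<close> holds at all vertices of a simplex or at none, the set contains a
  closed cell or misses it, which makes it open in the weak topology. A vertex property and its
  negation thus yield two open sets.\<close>

lemma openin_support_meets:
  assumes "\<And>s i j. s \<in> T \<Longrightarrow> i \<in> s \<Longrightarrow> j \<in> s \<Longrightarrow> P i \<Longrightarrow> P j"
  shows "openin (geometric_realization T) {x \<in> \<Union>(closed_cell ` T). \<exists>v. P v \<and> x v \<noteq> 0}"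
    (is "openin _ ?U")
  unfolding openin_geometric_realization
proof (intro conjI ballI)
  fix s assume s: "s \<in> T"
  have "?U \<inter> closed_cell s = {} \<or> ?U \<inter> closed_cell s = closed_cell s"
  proof (cases "\<exists>i\<in>s. P i")
    case True
    then obtain i where "i \<in> s" "P i" by blast
    then have P: "\<forall>j\<in>s. P j" using assms[OF s \<open>i \<in> s\<close>] by simp
    \<comment> \<open>Barycentric coordinates sum to 1, so one of them is nonzero at a vertex of
      \<open>s\<close>.\<close>
    have "x \<in> ?U" if x: "x \<in> closed_cell s" for x
    proof -
      have "sum x s = 1" using x by (simp add: closed_cell_def)
      then have "\<exists>v\<in>s. x v \<noteq> 0" by (metis sum.neutral zero_neq_one)
      then show ?thesis using P s x by blast
    qed
    then show ?thesis by blast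
  next
    case False
    then show ?thesis by (auto simp: closed_cell_def)
  qed
  then show "openin (subtopology (powertop_real UNIV) (closed_cell s)) (?U \<inter> closed_cell s)"
  proof
    assume "?U \<inter> closed_cell s = closed_cell s"
    moreover have "topspace (subtopology (powertop_real UNIV) (closed_cell s)) = closed_cell s"
      by simp
    ultimately show ?thesis by (metis openin_topspace)
  qed simp
qed auto

text \<open>Induction along edges, the form in which connectedness is used below. If
  \<open>P\<close> failed at \<open>v\<close>, the points whose support meets \<open>P\<close> and
  those whose support meets its negation would disconnect the realization.\<close>

lemma connected_complex_induct:
  assumes sc: "simplicial_complex_on T"
    and conn: "connected_space (geometric_realization T)"
    and a: "a \<in> vertices T" "P a"
    and step: "\<And>i j. {i, j} \<in> simplices T 1 \<Longrightarrow> P i \<Longrightarrow> P j"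
    and v: "v \<in> vertices T"
  shows "P v"
proof (rule ccontr)
  assume "\<not> P v"
  have P: "P j" if "s \<in> T" "i \<in> s" "j \<in> s" "P i" for s i j
    using edge_in_simplices[OF sc that(1-3)] step that(4) by blast
  let ?X = "\<Union>(closed_cell ` T)"
  let ?U = "{x \<in> ?X. \<exists>v. P v \<and> x v \<noteq> 0}"
  let ?V = "{x \<in> ?X. \<exists>v. \<not> P v \<and> x v \<noteq> 0}"
  have opens: "openin (geometric_realization T) ?U" "openin (geometric_realization T) ?V"
    by (rule openin_support_meets, use P in blast)+
  have cover: "?X \<subseteq> ?U \<union> ?V"
  proof
    fix x assume x: "x \<in> ?X"
    then obtain s where "s \<in> T" "(\<Sum>v\<in>s. x v) = 1" by (auto simp: closed_cell_def)
    then obtain u where "x u \<noteq> 0" by (metis sum.neutral zero_neq_one)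
    with x show "x \<in> ?U \<union> ?V" by blast
  qed
  have disjoint: "?U \<inter> ?V = {}"
  proof -
    \<comment> \<open>The support of a point lies in a single simplex, on which \<open>P\<close>
      cannot change.\<close>
    have False if "s \<in> T" "x \<in> closed_cell s" "P i" "x i \<noteq> 0" "\<not> P j" "x j \<noteq> 0" for s x i j
      using that P[of s i j] by (auto simp: closed_cell_def)
    then show ?thesis by blast
  qed
  have pt: "(\<lambda>u. if u = c then 1 else 0) \<in> ?X" if "c \<in> vertices T" for c
  proof -
    have "{c} \<in> T" using that by (simp add: vertices_def simplices_def)
    moreover have "(\<lambda>u. if u = c then 1 else 0) \<in> closed_cell {c}"
      by (simp add: closed_cell_def)
    ultimately show ?thesis by blast
  qed
  have "(\<lambda>u. if u = a then 1 else 0) \<in> ?U" "(\<lambda>u. if u = v then 1 else 0) \<in> ?V"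
    using pt a v \<open>\<not> P v\<close> by auto
  then have nonempty: "?U \<noteq> {}" "?V \<noteq> {}" by blast+
  show False
    using connected_spaceD[OF conn opens _ disjoint nonempty] cover
    unfolding topspace_geometric_realization by blast
qed

section \<open>Summation along walks in the edge graph\<close>

text \<open>This is a relation because, without the loop condition, the sum may depend on the walk.
  Walks grow at their end while the base point \<open>a\<close> stays fixed.\<close>

inductive walk_sum :: "'v set set \<Rightarrow> ('v \<times> 'v \<Rightarrow> real) \<Rightarrow> 'v \<Rightarrow> 'v \<Rightarrow> real \<Rightarrow> bool"
  for T d a where
  refl: "a \<in> vertices T \<Longrightarrow> walk_sum T d a a 0"
| snoc: "walk_sum T d a u x \<Longrightarrow> {u, v} \<in> simplices T 1
    \<Longrightarrow> walk_sum T d a v (x + ((d (v, u))\<^sup>2 - (d (u, v))\<^sup>2))"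

lemma walk_sum_trans:
  assumes "walk_sum T d b c y" "walk_sum T d a b x"
  shows "walk_sum T d a c (x + y)"
  using assms
proof (induction rule: walk_sum.induct)
  case (snoc u y v)
  from walk_sum.snoc[OF snoc.IH[OF snoc.prems] snoc.hyps(2)] show ?case
    by (simp add: algebra_simps)
qed simp

text \<open>Traversing an edge backwards changes the sign of its summand.\<close>

lemma walk_sum_sym:
  assumes "simplicial_complex_on T" "walk_sum T d a b x"
  shows "walk_sum T d b a (- x)"
  using assms(2)
proof (induction rule: walk_sum.induct)
  case refl
  then show ?case by (simp add: walk_sum.refl)
next
  case (snoc u x v)
  \<comment> \<open>The reversed last edge is a walk of its own, to which the reversed initial part
    gets appended; \<open>0 +\<close> matches the conclusion of
    \<open>walk_sum.snoc\<close>.\<close>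
  have "walk_sum T d v u (0 + ((d (u, v))\<^sup>2 - (d (v, u))\<^sup>2))"
    using snoc.hyps edge_vertices[OF assms(1)]
    by (intro walk_sum.snoc walk_sum.refl) (auto simp: insert_commute)
  from walk_sum_trans[OF snoc.IH this] show ?case
    by (simp add: algebra_simps)
qed

text \<open>Translates inductive walks into the indexed sequences over which
  \<open>loop_condition\<close> quantifies.\<close>

lemma walk_sum_imp_sequence:
  assumes "simplicial_complex_on T" "walk_sum T d a b x"
  shows "\<exists>(r::nat) i. i 0 = a \<and> i r = b \<and> (\<forall>k\<le>r. i k \<in> vertices T) \<and>
    (\<forall>k\<in>{1..r}. {i (k - 1), i k} \<in> simplices T 1) \<and>
    (\<Sum>k=1..r. (d (i k, i (k - 1)))\<^sup>2 - (d (i (k - 1), i k))\<^sup>2) = x"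
  using assms(2)
proof (induction rule: walk_sum.induct)
  case refl
  then show ?case by (intro exI[of _ 0] exI[of _ "\<lambda>_. a"]) simp
next
  case (snoc u x v)
  then obtain r :: nat and i where i: "i 0 = a" "i r = u" "\<forall>k\<le>r. i k \<in> vertices T"
    "\<forall>k\<in>{1..r}. {i (k - 1), i k} \<in> simplices T 1"
    "(\<Sum>k=1..r. (d (i k, i (k - 1)))\<^sup>2 - (d (i (k - 1), i k))\<^sup>2) = x"
    by blast
  \<comment> \<open>The new vertex sits at index \<open>Suc r\<close>, so the summands up to
    \<open>r\<close> are unchanged.\<close>
  let ?i = "i(Suc r := v)"
  have "(\<Sum>k=1..r. (d (?i k, ?i (k - 1)))\<^sup>2 - (d (?i (k - 1), ?i k))\<^sup>2) = x"
    unfolding i(5)[symmetric] by (rule sum.cong) auto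
  then have "(\<Sum>k=1..Suc r. (d (?i k, ?i (k - 1)))\<^sup>2 - (d (?i (k - 1), ?i k))\<^sup>2)
      = x + ((d (v, u))\<^sup>2 - (d (u, v))\<^sup>2)"
    using i(2) by simp
  moreover have "\<forall>k\<le>Suc r. ?i k \<in> vertices T"
    using i(3) edge_vertices(2)[OF assms(1) snoc.hyps(2)] by (auto simp: le_Suc_eq)
  moreover have "\<forall>k\<in>{1..Suc r}. {?i (k - 1), ?i k} \<in> simplices T 1"
    using i(2,4) snoc.hyps(2) by (auto simp: le_Suc_eq)
  ultimately show ?case
    using i(1) by (intro exI[of _ "Suc r"] exI[of _ ?i]) simp
qed

text \<open>The first walk followed by the reverse of the second is a loop at \<open>a\<close> with
  sum \<open>x - y\<close>, which the loop condition forces to be 0.\<close>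

lemma walk_sum_unique:
  assumes sc: "simplicial_complex_on T" and loop: "loop_condition T d"
    and "walk_sum T d a b x" "walk_sum T d a b y"
  shows "x = y"
proof -
  have "walk_sum T d a a (x + - y)"
    using walk_sum_trans[OF walk_sum_sym[OF sc assms(4)] assms(3)] .
  from walk_sum_imp_sequence[OF sc this] obtain r :: nat and i where i: "i 0 = a" "i r = a"
      "\<forall>k\<le>r. i k \<in> vertices T" "\<forall>k\<in>{1..r}. {i (k - 1), i k} \<in> simplices T 1"
    and sum: "(\<Sum>k=1..r. (d (i k, i (k - 1)))\<^sup>2 - (d (i (k - 1), i k))\<^sup>2) = x + - y"
    by blast
  have "i 0 = i r" using i(1,2) by simp
  with loop i(3,4) have "(\<Sum>k=1..r. (d (i k, i (k - 1)))\<^sup>2 - (d (i (k - 1), i k))\<^sup>2) = 0"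
    unfolding loop_condition_def by blast
  with sum show ?thesis by simp
qed

text \<open>Discrete integration: the value at a vertex is the sum along a walk from a base vertex.
  Connectedness supplies the walk, and the loop condition makes its choice immaterial.\<close>

lemma potential_exists:
  assumes sc: "simplicial_complex_on T"
    and conn: "connected_space (geometric_realization T)"
    and loop: "loop_condition T d"
  shows "\<exists>w\<in>vertices T \<rightarrow>\<^sub>E UNIV. \<forall>i j. {i, j} \<in> simplices T 1 \<longrightarrow>
    w j - w i = (d (j, i))\<^sup>2 - (d (i, j))\<^sup>2"
proof (cases "vertices T = {}")
  case True
  \<comment> \<open>Without vertices there are no edges, and the only extensional function on the
    empty set is constantly \<open>undefined\<close>.\<close>
  then show ?thesis using edge_vertices[OF sc] by (auto intro!: exI[of _ "\<lambda>_. undefined"])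
next
  case False
  then obtain a where a: "a \<in> vertices T" by blast
  have ex: "\<exists>x. walk_sum T d a v x" if "v \<in> vertices T" for v
    using sc conn a
  proof (rule connected_complex_induct)
    show "\<exists>x. walk_sum T d a a x" using walk_sum.refl[OF a] by blast
    show "\<exists>x. walk_sum T d a j x" if "{i, j} \<in> simplices T 1" "\<exists>x. walk_sum T d a i x" for i j
      using that walk_sum.snoc by metis
  qed (rule that)
  define w where "w = (\<lambda>v\<in>vertices T. SOME x. walk_sum T d a v x)"
  have w: "walk_sum T d a v (w v)" if "v \<in> vertices T" for v
    using someI_ex[OF ex[OF that]] that by (simp add: w_def)
  \<comment> \<open>The walk chosen for \<open>i\<close>, prolonged by the edge to \<open>j\<close>,
    must have the same sum as the walk chosen for \<open>j\<close>.\<close>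
  have "w j - w i = (d (j, i))\<^sup>2 - (d (i, j))\<^sup>2" if e: "{i, j} \<in> simplices T 1" for i j
    using walk_sum_unique[OF sc loop w[OF edge_vertices(2)[OF sc e]]
        walk_sum.snoc[OF w[OF edge_vertices(1)[OF sc e]] e]]
    by simp
  then show ?thesis by (intro bexI[of _ w] allI impI) (simp_all add: w_def)
qed

section \<open>Weights and duality data on a single edge, around triangles and along loops\<close>

text \<open>With \<open>L = len {i, j}\<close>, factoring the difference of squares gives
  \<open>w j - w i = L * (d (j, i) - d (i, j))\<close>; hence the numerator of the defining formula
  is \<open>2 * L * d (i, j)\<close>.\<close>

lemma weighted_to_duality_eqI:
  assumes "len {i, j} > 0" "{i, j} \<in> simplices T 1" "len {i, j} = d (i, j) + d (j, i)"
    and "w j - w i = (d (j, i))\<^sup>2 - (d (i, j))\<^sup>2"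
  shows "weighted_to_duality T (len, w) (i, j) = d (i, j)"
proof -
  have "(len {i, j})\<^sup>2 + w i - w j = d (i, j) * (2 * len {i, j})"
    using assms(3,4) by (simp add: power2_eq_square algebra_simps)
  then show ?thesis
    using assms(1,2) by (simp add: weighted_to_duality_def directed_edges_def)
qed

context
  fixes T :: "'v set set" and len :: "'v set \<Rightarrow> real" and w :: "'v \<Rightarrow> real"
  assumes wt: "(len, w) \<in> weighted_triangulations T"
begin

lemma len_pos:
  assumes "e \<in> simplices T 1"
  shows "len e > 0"
proof -
  have "len \<in> simplices T 1 \<rightarrow>\<^sub>E {0<..}"
    using wt by (simp add: weighted_triangulations_def euclidean_triangulations_def)
  from PiE_mem[OF this assms] show ?thesis by simp
qed

lemma weighted_to_duality_edge:
  assumes "{i, j} \<in> simplices T 1"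
  shows "weighted_to_duality T (len, w) (i, j) = ((len {i, j})\<^sup>2 + w i - w j) / (2 * len {i, j})"
    and "weighted_to_duality T (len, w) (j, i) = ((len {i, j})\<^sup>2 + w j - w i) / (2 * len {i, j})"
proof -
  have "{j, i} = {i, j}" by (rule insert_commute)
  then show "weighted_to_duality T (len, w) (j, i) = ((len {i, j})\<^sup>2 + w j - w i) / (2 * len {i, j})"
    using assms by (simp add: weighted_to_duality_def directed_edges_def)
qed (use assms in \<open>simp add: weighted_to_duality_def directed_edges_def\<close>)

lemma weighted_to_duality_sum:
  assumes "{i, j} \<in> simplices T 1"
  shows "weighted_to_duality T (len, w) (i, j) + weighted_to_duality T (len, w) (j, i) = len {i, j}"
  unfolding weighted_to_duality_edge[OF assms] add_divide_distrib[symmetric]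
  using len_pos[OF assms] by (simp add: power2_eq_square)

text \<open>The difference of squares is the product of \<open>(w j - w i) / len {i, j}\<close> and
  the sum \<open>len {i, j}\<close>, so the length cancels.\<close>

lemma weighted_to_duality_diff:
  assumes "{i, j} \<in> simplices T 1"
  shows "(weighted_to_duality T (len, w) (j, i))\<^sup>2 - (weighted_to_duality T (len, w) (i, j))\<^sup>2
    = w j - w i"
proof -
  let ?d = "weighted_to_duality T (len, w)"
  have "?d (j, i) - ?d (i, j) = (2 * (w j - w i)) / (2 * len {i, j})"
    unfolding weighted_to_duality_edge[OF assms] diff_divide_distrib[symmetric]
    by (rule arg_cong2[where f = "(/)"]) simp_all
  then have "?d (j, i) - ?d (i, j) = (w j - w i) / len {i, j}"
    by (simp only: mult_divide_mult_cancel_left_if) simp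
  moreover have "(?d (j, i))\<^sup>2 - (?d (i, j))\<^sup>2 = (?d (j, i) - ?d (i, j)) * (?d (i, j) + ?d (j, i))"
    by (simp add: power2_eq_square algebra_simps)
  ultimately show ?thesis
    using len_pos[OF assms] by (simp add: weighted_to_duality_sum[OF assms])
qed

text \<open>The triangle identity holds because the weight differences along its three edges add up
  to 0; the induced lengths are \<open>len\<close> itself.\<close>

lemma weighted_to_duality_in_duality_triangulations:
  assumes sc: "simplicial_complex_on T"
  shows "weighted_to_duality T (len, w) \<in> duality_triangulations T"
  unfolding duality_triangulations_def
proof (intro CollectI conjI allI impI)
  let ?d = "weighted_to_duality T (len, w)"
  show "?d \<in> directed_edges T \<rightarrow>\<^sub>E UNIV"
    by (simp add: weighted_to_duality_def)
  show "(?d (i, j))\<^sup>2 + (?d (j, k))\<^sup>2 + (?d (k, i))\<^sup>2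
      = (?d (j, i))\<^sup>2 + (?d (i, k))\<^sup>2 + (?d (k, j))\<^sup>2"
    if s: "{i, j, k} \<in> simplices T 2" for i j k
  proof -
    have T: "{i, j, k} \<in> T" and card: "card {i, j, k} = 3" using s by (simp_all add: simplices_def)
    have "i \<noteq> j" "j \<noteq> k" "k \<noteq> i"
      using card by (auto simp: card_insert_if split: if_splits)
    then have "{i, j} \<in> simplices T 1" "{j, k} \<in> simplices T 1" "{k, i} \<in> simplices T 1"
      using edge_in_simplices[OF sc T] by simp_all
    then show ?thesis
      using weighted_to_duality_diff[of i j] weighted_to_duality_diff[of j k]
        weighted_to_duality_diff[of k i] by linarith
  qed
  show "\<exists>len\<in>euclidean_triangulations T. \<forall>(i, j)\<in>directed_edges T. len {i, j} = ?d (i, j) + ?d (j, i)"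
  proof (rule bexI[of _ len])
    show "len \<in> euclidean_triangulations T"
      using wt by (simp add: weighted_triangulations_def)
    show "\<forall>(i, j)\<in>directed_edges T. len {i, j} = ?d (i, j) + ?d (j, i)"
      by (simp add: directed_edges_def weighted_to_duality_sum split_beta)
  qed
qed

text \<open>Each summand is a weight difference, so the sum telescopes.\<close>

lemma loop_condition_weighted_to_duality: "loop_condition T (weighted_to_duality T (len, w))"
  unfolding loop_condition_def
proof (intro allI impI, elim conjE)
  fix r :: nat and i :: "nat \<Rightarrow> 'v"
  let ?d = "weighted_to_duality T (len, w)"
  assume closed: "i 0 = i r" and edges: "\<forall>k\<in>{1..r}. {i (k - 1), i k} \<in> simplices T 1"
  have "(\<Sum>k=1..r. (?d (i k, i (k - 1)))\<^sup>2 - (?d (i (k - 1), i k))\<^sup>2)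
      = (\<Sum>k=1..r. w (i k) - w (i (k - 1)))"
    using edges weighted_to_duality_diff by (intro sum.cong) auto
  also have "\<dots> = w (i r) - w (i 0)"
    by (induction r) auto
  finally show "(\<Sum>k=1..r. (?d (i k, i (k - 1)))\<^sup>2 - (?d (i (k - 1), i k))\<^sup>2) = 0"
    using closed by simp
qed

end

section \<open>Classes modulo weight scalings, injectivity and image\<close>

text \<open>Only the difference of the weights at the ends of an edge enters the formula, so
  \<open>t\<close> cancels.\<close>

lemma weighted_to_duality_respects:
  assumes sc: "simplicial_complex_on T"
  shows "weighted_to_duality T respects weight_scaling T"
proof (rule congruentI)
  fix p q assume "(p, q) \<in> weight_scaling T"
  then obtain len w w' t where p: "p = (len, w)" "q = (len, w')" "\<forall>i\<in>vertices T. w' i = w i + t"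
    by (auto simp: weight_scaling_def)
  then show "weighted_to_duality T p = weighted_to_duality T q"
    using edge_vertices[OF sc]
    by (auto simp: weighted_to_duality_def directed_edges_def fun_eq_iff restrict_def)
qed

text \<open>Sums over both directions of an edge recover the lengths, differences of squares the
  increments of the weights. So \<open>w'\<close> and \<open>w\<close> differ by equal amounts at
  adjacent vertices, hence by a constant.\<close>

lemma weighted_to_duality_eqD:
  assumes sc: "simplicial_complex_on T"
    and conn: "connected_space (geometric_realization T)"
    and p: "p \<in> weighted_triangulations T" and q: "q \<in> weighted_triangulations T"
    and eq: "weighted_to_duality T p = weighted_to_duality T q"
  shows "(p, q) \<in> weight_scaling T"
proof -
  obtain len w len' w' where pq: "p = (len, w)" "q = (len', w')" by fastforce
  note p = p[unfolded pq] and q = q[unfolded pq] and eq = eq[unfolded pq]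
  have len: "len {i, j} = len' {i, j}" if "{i, j} \<in> simplices T 1" for i j
    using weighted_to_duality_sum[OF p that] weighted_to_duality_sum[OF q that] eq by simp
  have "len' = len"
  proof (rule PiE_ext)
    show "len' \<in> simplices T 1 \<rightarrow>\<^sub>E {0<..}" "len \<in> simplices T 1 \<rightarrow>\<^sub>E {0<..}"
      using p q by (simp_all add: weighted_triangulations_def euclidean_triangulations_def)
    fix e assume e: "e \<in> simplices T 1"
    then have "card e = 2" by (simp add: simplices_def)
    then show "len' e = len e" using e len by (auto simp: card_2_iff)
  qed
  moreover have "\<exists>t. \<forall>i\<in>vertices T. w' i = w i + t"
  proof (cases "vertices T = {}")
    case False
    then obtain a where a: "a \<in> vertices T" by blast
    \<comment> \<open>The shift \<open>t\<close> is read off at the base vertex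
      \<open>a\<close>.\<close>
    have step: "w' j = w j + (w' a - w a)"
      if "{i, j} \<in> simplices T 1" "w' i = w i + (w' a - w a)" for i j
      using weighted_to_duality_diff[OF p that(1)] weighted_to_duality_diff[OF q that(1)] eq that(2)
      by simp
    have "\<forall>v\<in>vertices T. w' v = w v + (w' a - w a)"
      using connected_complex_induct[OF sc conn a, where P = "\<lambda>v. w' v = w v + (w' a - w a)"] step
      by simp
    then show ?thesis by blast
  qed simp
  ultimately show ?thesis
    using p q pq by (simp add: weight_scaling_def)
qed

text \<open>To reach a given \<open>d\<close>, take its induced lengths and the weights from
  \<open>potential_exists\<close>; \<open>weighted_to_duality_eqI\<close> then returns
  \<open>d\<close> on each directed edge.\<close>

lemma weighted_to_duality_image:
  assumes sc: "simplicial_complex_on T"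
    and conn: "connected_space (geometric_realization T)"
  shows "weighted_to_duality T ` weighted_triangulations T
    = {d \<in> duality_triangulations T. loop_condition T d}" (is "?f ` _ = ?D")
proof
  show "?f ` weighted_triangulations T \<subseteq> ?D"
    using weighted_to_duality_in_duality_triangulations[OF _ sc]
      loop_condition_weighted_to_duality by auto
  show "?D \<subseteq> ?f ` weighted_triangulations T"
  proof
    fix d assume d: "d \<in> ?D"
    then obtain len where len: "len \<in> euclidean_triangulations T"
      "\<And>i j. {i, j} \<in> simplices T 1 \<Longrightarrow> len {i, j} = d (i, j) + d (j, i)"
      by (auto simp: duality_triangulations_def directed_edges_def)
    obtain w where w: "w \<in> vertices T \<rightarrow>\<^sub>E UNIV"
      "\<And>i j. {i, j} \<in> simplices T 1 \<Longrightarrow> w j - w i = (d (j, i))\<^sup>2 - (d (i, j))\<^sup>2"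
      using potential_exists[OF sc conn, of d] d by blast
    have wt: "(len, w) \<in> weighted_triangulations T"
      using len w by (simp add: weighted_triangulations_def)
    have "?f (len, w) = d"
    proof (rule PiE_ext)
      show "?f (len, w) \<in> directed_edges T \<rightarrow>\<^sub>E UNIV"
        by (simp add: weighted_to_duality_def)
      show "d \<in> directed_edges T \<rightarrow>\<^sub>E UNIV"
        using d by (simp add: duality_triangulations_def)
      show "?f (len, w) e = d e" if "e \<in> directed_edges T" for e
        using that weighted_to_duality_eqI[where len = len and w = w, OF len_pos[OF wt]] len(2) w(2)
        by (auto simp: directed_edges_def)
    qed
    with wt show "d \<in> ?f ` weighted_triangulations T" by blast
  qed
qed

text \<open>All members of a class have the same value, so \<open>the_elem\<close> acts on a
  singleton.\<close>

lemma induced_map_class: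
  assumes "equiv A r" "f respects r" "a \<in> A"
  shows "induced_map f (r `` {a}) = f a"
proof -
  have "f ` (r `` {a}) = {f a}"
    using assms by (auto simp: congruent_def image_iff dest: equiv_class_self)
  then show ?thesis by (simp add: induced_map_def)
qed

lemma induced_map_image:
  assumes "equiv A r" "f respects r"
  shows "induced_map f ` (A // r) = f ` A"
proof -
  have "induced_map f ` (A // r) = (\<lambda>a. induced_map f (r `` {a})) ` A"
    unfolding quotient_def by blast
  also have "\<dots> = f ` A"
    by (rule image_cong) (simp_all add: induced_map_class[OF assms])
  finally show ?thesis .
qed

theorem theorem11:
  fixes T :: "'v set set" and M :: "'m topology" and n :: nat
  assumes "topological_manifold n M" and "connected_space M" and "triangulates T M"
  shows "weighted_to_duality T respects weight_scaling T \<and>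
    induced_map (weighted_to_duality T)
      \<in> weighted_triangulations T // weight_scaling T \<rightarrow> duality_triangulations T \<and>
    inj_on (induced_map (weighted_to_duality T))
      (weighted_triangulations T // weight_scaling T) \<and>
    bij_betw (induced_map (weighted_to_duality T))
      (weighted_triangulations T // weight_scaling T)
      {d \<in> duality_triangulations T. loop_condition T d}"
proof -
  have sc: "simplicial_complex_on T" and conn: "connected_space (geometric_realization T)"
    using assms homeomorphic_connected_space by (auto simp: triangulates_def)
  note eqv = equiv_weight_scaling[of T]
  note resp = weighted_to_duality_respects[OF sc]
  have image: "induced_map (weighted_to_duality T) ` (weighted_triangulations T // weight_scaling T)
      = {d \<in> duality_triangulations T. loop_condition T d}"
    by (simp add: induced_map_image[OF eqv resp] weighted_to_duality_image[OF sc conn])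
  have inj: "inj_on (induced_map (weighted_to_duality T))
      (weighted_triangulations T // weight_scaling T)"
  proof (rule inj_onI)
    fix C D
    assume "C \<in> weighted_triangulations T // weight_scaling T"
      "D \<in> weighted_triangulations T // weight_scaling T"
      and eq: "induced_map (weighted_to_duality T) C = induced_map (weighted_to_duality T) D"
    then obtain p q where C: "C = weight_scaling T `` {p}" "p \<in> weighted_triangulations T"
      and D: "D = weight_scaling T `` {q}" "q \<in> weighted_triangulations T"
      by (auto elim!: quotientE)
    have "weighted_to_duality T p = weighted_to_duality T q"
      using eq C D induced_map_class[OF eqv resp] by simp
    from weighted_to_duality_eqD[OF sc conn C(2) D(2) this] show "C = D"
      using C D equiv_class_eq[OF eqv] by simp
  qed
  \<comment> \<open>Besides surjectivity, \<open>image\<close> also yields that values lie in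
    \<open>duality_triangulations T\<close>.\<close>
  show ?thesis
    using resp image inj by (auto simp: bij_betw_def)
qed

end
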